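(* Let $n\ge1$, let $\rho=\{r_1,\ldots,r_n\}$ with $0<r_1<\cdots<r_n<\infty$, and let $\nu_1,\ldots,\nu_n$ be arbitrary real values. Let $\sigma^B\in\mathcal{S}_0(\rho)$ be the unique non-singular Beppo Levi $L_0$-spline with $\sigma^B(r_j)=\nu_j$ for $1\le j\le n$. For $0<R_1<R_2<\infty$ with $r_1,\ldots,r_n\in[R_1,R_2]$, let $s_{R_1,R_2}:[R_1,R_2]\to\mathbb{R}$ be the minimizer of $$\int_{R_1}^{R_2}\left(r|f''(r)|^2+\frac1r|f'(r)|^2\right)dr$$ subject to $f(r_j)=\nu_j$ for $1\le j\le n$. Then $\sigma^B$ coincides with the pointwise limit of $s_{R_1,R_2}$ as $R_1\to0$ and $R_2\to\infty$; that is, for every $r\in(0,\infty)$, $s_{R_1,R_2}(r)\to\sigma^B(r)$ as $R_1\to0$ and $R_2\to\infty$.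
   Context: The minimization defining $s_{R_1,R_2}$ is over functions $f\in C^1[R_1,R_2]$ with $f'$ absolutely continuous and $f''\in L^2[R_1,R_2]$; the minimizer exists and is unique. Define the differential operators $$L_0=r\frac{d^4}{dr^4}+2\frac{d^3}{dr^3}-\frac1r\frac{d^2}{dr^2}+\frac1{r^2}\frac{d}{dr},\quad G_0=\frac{d^3}{dr^3}-\frac1r\frac{d^2}{dr^2}+\frac1{r^2}\frac{d}{dr},\quad R_0=\frac1r\left[\frac{d^2}{dr^2}+\frac1r\frac{d}{dr}\right].$$ On any open subinterval of $(0,\infty)$ their null spaces are $\mathrm{Ker}\,L_0=\mathrm{span}\{r^2,r^2\ln r,1,\ln r\}$, $\mathrm{Ker}\,G_0=\mathrm{span}\{r^2,r^2\ln r,1\}$, $\mathrm{Ker}\,R_0=\mathrm{span}\{1,\ln r\}$. For knots $\rho=\{r_1<\cdots<r_n\}\subset(0,\infty)$, a function $\eta:[0,\infty)\to\mathbb{C}$, continuous at $0$, is called a Beppo Levi $L_0$-spline on $\rho$ if: (i) $L_0\eta(r)=0$ for all $r\in(r_j,r_{j+1})$ and all $j\in\{1,\ldots,n-1\}$; (ii) $G_0\eta(r)=0$ for all $r\in(0,r_1)$ and $R_0\eta(r)=0$ for all $r>r_n$; (iii) $\eta$ is $C^2$-continuous at each knot $r_1,\ldots,r_n$. The set of all such functions is $\mathcal{S}_0(\rho)$. A spline $\eta\in\mathcal{S}_0(\rho)$ is called non-singular if its restriction to $(0,r_1)$ belongs to $\mathrm{span}\{r^2,1\}$. For arbitrary real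 data $\nu_1,\ldots,\nu_n$ the non-singular interpolant $\sigma^B$ exists and is unique. *)

theory Defs
  imports "HOL-Analysis.Analysis"
begin

definition vderiv :: "real set \<Rightarrow> (real \<Rightarrow> 'a::real_normed_vector) \<Rightarrow> real \<Rightarrow> 'a" where
  "vderiv S f = (\<lambda>x. vector_derivative f (at x within S))"

definition nderiv :: "nat \<Rightarrow> (real \<Rightarrow> 'a::real_normed_vector) \<Rightarrow> real \<Rightarrow> 'a" where
  "nderiv k = (vderiv UNIV ^^ k)"

text \<open>For open \<open>S\<close>: derivatives of order \<open>1, \<dots>, m\<close> exist throughout \<open>S\<close>. Since
  \<^const>\<open>vector_derivative\<close> is total, this has to accompany every differential equation
  of order \<open>m\<close> below.\<close>

definition times_differentiable_on ::
    "nat \<Rightarrow> real set \<Rightarrow> (real \<Rightarrow> 'a::real_normed_vector) \<Rightarrow> bool" where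
  "times_differentiable_on m S f \<longleftrightarrow>
     (\<forall>k<m. \<forall>x\<in>S. nderiv k f differentiable (at x))"

definition Cm_at :: "nat \<Rightarrow> (real \<Rightarrow> 'a::real_normed_vector) \<Rightarrow> real \<Rightarrow> bool" where
  "Cm_at m f x \<longleftrightarrow>
     (\<exists>U. open U \<and> x \<in> U \<and> times_differentiable_on m U f \<and> continuous_on U (nderiv m f))"

definition L0 :: "(real \<Rightarrow> complex) \<Rightarrow> real \<Rightarrow> complex" where
  "L0 f x = x *\<^sub>R nderiv 4 f x + 2 *\<^sub>R nderiv 3 f x
            - (1 / x) *\<^sub>R nderiv 2 f x + (1 / x\<^sup>2) *\<^sub>R nderiv 1 f x"

definition G0 :: "(real \<Rightarrow> complex) \<Rightarrow> real \<Rightarrow> complex" where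
  "G0 f x = nderiv 3 f x - (1 / x) *\<^sub>R nderiv 2 f x + (1 / x\<^sup>2) *\<^sub>R nderiv 1 f x"

definition R0 :: "(real \<Rightarrow> complex) \<Rightarrow> real \<Rightarrow> complex" where
  "R0 f x = (1 / x) *\<^sub>R (nderiv 2 f x + (1 / x) *\<^sub>R nderiv 1 f x)"

text \<open>The knots are \<open>r 1 < \<dots> < r n\<close>. A function on \<open>[0,\<infinity>)\<close> is represented by a
  function on all reals whose values on the negative half-line are irrelevant.\<close>

definition beppo_levi_splines :: "nat \<Rightarrow> (nat \<Rightarrow> real) \<Rightarrow> (real \<Rightarrow> complex) set" where
  "beppo_levi_splines n r = {\<eta>.
     continuous (at 0 within {0..}) \<eta> \<and>
     (\<forall>j\<in>{1..<n}. times_differentiable_on 4 {r j<..<r (Suc j)} \<eta> \<and>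
                    (\<forall>x\<in>{r j<..<r (Suc j)}. L0 \<eta> x = 0)) \<and>
     times_differentiable_on 3 {0<..<r 1} \<eta> \<and> (\<forall>x\<in>{0<..<r 1}. G0 \<eta> x = 0) \<and>
     times_differentiable_on 2 {r n<..} \<eta> \<and> (\<forall>x\<in>{r n<..}. R0 \<eta> x = 0) \<and>
     (\<forall>j\<in>{1..n}. Cm_at 2 \<eta> (r j))}"

definition nonsingular_spline :: "(nat \<Rightarrow> real) \<Rightarrow> (real \<Rightarrow> complex) \<Rightarrow> bool" where
  "nonsingular_spline r \<eta> \<longleftrightarrow>
     (\<exists>a b. \<forall>x\<in>{0<..<r 1}. \<eta> x = a * of_real (x\<^sup>2) + b)"

definition absolutely_continuous_on ::
    "real set \<Rightarrow> (real \<Rightarrow> 'a::real_normed_vector) \<Rightarrow> bool" where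
  "absolutely_continuous_on S f \<longleftrightarrow>
     (\<forall>\<epsilon>>0. \<exists>\<delta>>0. \<forall>d T. d division_of T \<and> T \<subseteq> S \<and> (\<Sum>K\<in>d. Sup K - Inf K) < \<delta> \<longrightarrow>
        (\<Sum>K\<in>d. norm (f (Sup K) - f (Inf K))) < \<epsilon>)"

text \<open>Derivatives are taken within \<open>[a,b]\<close>, hence one-sided at the endpoints, and values of
  \<open>f\<close> outside \<open>[a,b]\<close> play no role. The almost everywhere differentiability of \<open>f'\<close>
  follows from absolute continuity (Lebesgue); it is listed because it is what gives
  meaning to \<open>f''\<close> in \<open>f'' \<in> L\<^sup>2\<close>.\<close>

definition admissible :: "real \<Rightarrow> real \<Rightarrow> (real \<Rightarrow> real) set" where
  "admissible a b = {f.
     (let f' = vderiv {a..b} f; f'' = vderiv {a..b} f' in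
       (\<forall>x\<in>{a..b}. f differentiable (at x within {a..b})) \<and>
       continuous_on {a..b} f' \<and>
       absolutely_continuous_on {a..b} f' \<and>
       (AE x in lebesgue_on {a..b}. f' differentiable (at x within {a..b})) \<and>
       f'' \<in> borel_measurable (lebesgue_on {a..b}) \<and>
       integrable (lebesgue_on {a..b}) (\<lambda>x. \<bar>f'' x\<bar>\<^sup>2))}"

definition energy :: "real \<Rightarrow> real \<Rightarrow> (real \<Rightarrow> real) \<Rightarrow> real" where
  "energy a b f =
     (let f' = vderiv {a..b} f; f'' = vderiv {a..b} f' in
       integral\<^sup>L (lebesgue_on {a..b}) (\<lambda>x. x * \<bar>f'' x\<bar>\<^sup>2 + 1 / x * \<bar>f' x\<bar>\<^sup>2))"

definition constrained_minimizer ::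
    "nat \<Rightarrow> (nat \<Rightarrow> real) \<Rightarrow> (nat \<Rightarrow> real) \<Rightarrow> real \<Rightarrow> real \<Rightarrow> (real \<Rightarrow> real) \<Rightarrow> bool" where
  "constrained_minimizer n r \<nu> a b =
     is_arg_min (energy a b) (\<lambda>f. f \<in> admissible a b \<and> (\<forall>j\<in>{1..n}. f (r j) = \<nu> j))"

end

theory Submission
  imports Defs
begin

text \<open>
  Why the statement holds. The weighted energy is a quadratic form whose Euler--Lagrange equation
  is \<open>L0 u = 0\<close>. Let \<open>u\<close> be the real part of the spline, \<open>s\<close> the minimizer on \<open>[R1, R2]\<close>, and
  \<open>h = s - u\<close>, which vanishes at the knots. Integrating by parts piece by piece, the first variation
  of the energy at \<open>u\<close> in the direction \<open>h\<close> loses all interior contributions, and what remains are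
  boundary terms at \<open>R1\<close> and \<open>R2\<close> (\<open>first_variation_spline\<close>). If \<open>u = a x\<^sup>2 / 2 + b\<close> near \<open>0\<close> and
  \<open>u = c + d ln x\<close> near infinity, these are \<open>- a R1 h'(R1)\<close> and \<open>- (d / R2) h'(R2)\<close>: so on a large interval
  \<open>u\<close> almost satisfies the natural boundary conditions of the minimizer.

  Since \<open>s\<close> has no more energy than \<open>u\<close>, the energy of \<open>h\<close> is at most twice the absolute value of
  these boundary terms. The energy in turn bounds \<open>h'\<close> uniformly, with a constant that does not
  depend on the interval (\<open>sup_bound_of_energy\<close>). Together this gives
  \<open>|h'| \<le> 6 (|d| / R2 + |a| R1)\<close>, and as \<open>h\<close> is zero at the first knot,
  \<open>|s x - u x| \<le> 6 (|d| / R2 + |a| R1) |x - r 1|\<close> (\<open>distance_to_spline_le\<close>). The right-hand side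
  tends to zero as \<open>R1\<close> tends to \<open>0\<close> and \<open>R2\<close> to infinity.

  The spline is complex-valued. Its imaginary part is a spline with zero data, for which the zero
  function is a minimizer on every interval; the same estimate shows that it vanishes.

  As \<open>s''\<close> exists only almost everywhere, the integrations by parts rest on a fundamental theorem of
  calculus for absolutely continuous functions
  (\<open>fundamental_theorem_of_calculus_absolutely_continuous\<close>).
\<close>

section \<open>Absolutely continuous functions\<close>

lemma absolutely_continuous_on_subset:
  "absolutely_continuous_on S f \<Longrightarrow> T \<subseteq> S \<Longrightarrow> absolutely_continuous_on T f"
  unfolding absolutely_continuous_on_def by (meson order_trans)

lemma division_of_real_memE:
  fixes T :: "real set"
  assumes "d division_of T" "K \<in> d"
  obtains "Inf K \<le> Sup K" "Inf K \<in> T" "Sup K \<in> T"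
proof -
  obtain u v where K: "K = cbox u v" "K \<noteq> {}" "K \<subseteq> T"
    using division_ofD[OF assms(1)] assms(2) by metis
  have "u \<le> v" using K by auto
  then have "Inf K = u" "Sup K = v" "u \<in> T" "v \<in> T" using K by auto
  then show thesis using that \<open>u \<le> v\<close> by simp
qed

text \<open>Every permanence property below is an instance of this one: the sums of increments of a function
  are controlled as soon as its single increments are controlled by those of two absolutely
  continuous functions.\<close>

lemma absolutely_continuous_on_if_dominated:
  fixes f :: "real \<Rightarrow> 'a::real_normed_vector"
    and g :: "real \<Rightarrow> 'b::real_normed_vector" and h :: "real \<Rightarrow> 'c::real_normed_vector"
  assumes g: "absolutely_continuous_on S g" and h: "absolutely_continuous_on S h"
    and dom: "\<And>x y. x \<in> S \<Longrightarrow> y \<in> S \<Longrightarrow>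
      norm (f y - f x) \<le> C * (norm (g y - g x) + norm (h y - h x))"
  shows "absolutely_continuous_on S f"
  unfolding absolutely_continuous_on_def
proof (intro allI impI)
  fix \<epsilon> :: real assume "\<epsilon> > 0"
  define C' where "C' = max C 1"
  have "C' > 0" by (simp add: C'_def)
  define e where "e = \<epsilon> / (2 * C')"
  have "e > 0" using \<open>\<epsilon> > 0\<close> \<open>C' > 0\<close> by (simp add: e_def)
  obtain \<delta>1 where \<delta>1: "\<delta>1 > 0" "\<And>d T. \<lbrakk>d division_of T; T \<subseteq> S; (\<Sum>K\<in>d. Sup K - Inf K) < \<delta>1\<rbrakk>
      \<Longrightarrow> (\<Sum>K\<in>d. norm (g (Sup K) - g (Inf K))) < e"
    using g \<open>e > 0\<close> unfolding absolutely_continuous_on_def by metis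
  obtain \<delta>2 where \<delta>2: "\<delta>2 > 0" "\<And>d T. \<lbrakk>d division_of T; T \<subseteq> S; (\<Sum>K\<in>d. Sup K - Inf K) < \<delta>2\<rbrakk>
      \<Longrightarrow> (\<Sum>K\<in>d. norm (h (Sup K) - h (Inf K))) < e"
    using h \<open>e > 0\<close> unfolding absolutely_continuous_on_def by metis
  show "\<exists>\<delta>>0. \<forall>d T. d division_of T \<and> T \<subseteq> S \<and> (\<Sum>K\<in>d. Sup K - Inf K) < \<delta> \<longrightarrow>
        (\<Sum>K\<in>d. norm (f (Sup K) - f (Inf K))) < \<epsilon>"
  proof (intro exI[of _ "min \<delta>1 \<delta>2"] conjI allI impI)
    show "min \<delta>1 \<delta>2 > 0" using \<delta>1(1) \<delta>2(1) by simp
    fix d T assume *: "d division_of T \<and> T \<subseteq> S \<and> (\<Sum>K\<in>d. Sup K - Inf K) < min \<delta>1 \<delta>2"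
    have "(\<Sum>K\<in>d. norm (f (Sup K) - f (Inf K)))
        \<le> (\<Sum>K\<in>d. C' * (norm (g (Sup K) - g (Inf K)) + norm (h (Sup K) - h (Inf K))))"
    proof (rule sum_mono)
      fix K assume "K \<in> d"
      then have "Inf K \<in> S" "Sup K \<in> S"
        using division_of_real_memE * by blast+
      then have "norm (f (Sup K) - f (Inf K))
          \<le> C * (norm (g (Sup K) - g (Inf K)) + norm (h (Sup K) - h (Inf K)))"
        by (intro dom)
      also have "\<dots> \<le> C' * (norm (g (Sup K) - g (Inf K)) + norm (h (Sup K) - h (Inf K)))"
        by (intro mult_right_mono) (auto simp: C'_def)
      finally show "norm (f (Sup K) - f (Inf K))
          \<le> C' * (norm (g (Sup K) - g (Inf K)) + norm (h (Sup K) - h (Inf K)))" .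
    qed
    also have "\<dots> = C' * ((\<Sum>K\<in>d. norm (g (Sup K) - g (Inf K))) + (\<Sum>K\<in>d. norm (h (Sup K) - h (Inf K))))"
      by (simp add: sum_distrib_left[symmetric] sum.distrib)
    also have "\<dots> < C' * (e + e)"
      using * \<open>C' > 0\<close> by (intro mult_strict_left_mono add_strict_mono \<delta>1(2)[of d T] \<delta>2(2)[of d T]) auto
    also have "\<dots> = \<epsilon>" using \<open>C' > 0\<close> by (simp add: e_def)
    finally show "(\<Sum>K\<in>d. norm (f (Sup K) - f (Inf K))) < \<epsilon>" .
  qed
qed

lemma absolutely_continuous_on_diff:
  assumes "absolutely_continuous_on S f" "absolutely_continuous_on S g"
  shows "absolutely_continuous_on S (\<lambda>x. f x - g x)"
proof (rule absolutely_continuous_on_if_dominated[OF assms, of _ 1])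
  show "norm (f y - g y - (f x - g x)) \<le> 1 * (norm (f y - f x) + norm (g y - g x))" for x y
    using norm_triangle_ineq4[of "f y - f x" "g y - g x"] by (simp add: algebra_simps)
qed

lemma absolutely_continuous_on_ident: "absolutely_continuous_on S (\<lambda>x::real. x)"
  unfolding absolutely_continuous_on_def
proof (intro allI impI)
  fix \<epsilon> :: real assume "\<epsilon> > 0"
  have "(\<Sum>K\<in>d. norm (Sup K - Inf K)) = (\<Sum>K\<in>d. Sup K - Inf K)"
    if "d division_of T" for d :: "real set set" and T
  proof (rule sum.cong[OF refl])
    show "norm (Sup K - Inf K) = Sup K - Inf K" if "K \<in> d" for K
      by (rule division_of_real_memE[OF \<open>d division_of T\<close> that]) simp
  qed
  then show "\<exists>\<delta>>0. \<forall>d T. d division_of T \<and> T \<subseteq> S \<and> (\<Sum>K\<in>d. Sup K - Inf K) < \<delta> \<longrightarrow>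
      (\<Sum>K\<in>d. norm (Sup K - Inf K)) < \<epsilon>"
    using \<open>\<epsilon> > 0\<close> by (intro exI[of _ \<epsilon>]) auto
qed

text \<open>The derivative is only asked for in the open interval, because \<open>x u''\<close>, to which
  this applies for a spline \<open>u\<close>, is smooth between two knots but need not be differentiable at the knots.\<close>

lemma bounded_derivative_imp_absolutely_continuous_on:
  fixes f :: "real \<Rightarrow> real"
  assumes cont: "continuous_on {a..b} f"
    and deriv: "\<And>x. x \<in> {a<..<b} \<Longrightarrow> (f has_real_derivative f' x) (at x)"
    and bnd: "bounded (f' ` {a<..<b})"
  shows "absolutely_continuous_on {a..b} f"
proof -
  obtain L where L: "\<And>x. x \<in> {a<..<b} \<Longrightarrow> \<bar>f' x\<bar> \<le> L"
    using bnd unfolding bounded_iff by (metis imageI real_norm_def)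
  have le: "\<bar>f y - f x\<bar> \<le> L * (y - x)" if xy: "x \<in> {a..b}" "y \<in> {a..b}" "x < y" for x y
  proof -
    have "continuous_on {x..y} f"
      by (rule continuous_on_subset[OF cont]) (use xy in auto)
    moreover have "f differentiable (at z)" if "x < z" "z < y" for z
      using deriv[of z] that xy by (auto simp: real_differentiable_def)
    ultimately obtain l z where z: "x < z" "z < y" "DERIV f z :> l" "f y - f x = (y - x) * l"
      using MVT[OF \<open>x < y\<close>, of f] by blast
    then have "l = f' z" using deriv[of z] xy DERIV_unique by fastforce
    then show ?thesis using L[of z] z xy by (simp add: abs_mult mult.commute mult_left_mono)
  qed
  show ?thesis
  proof (rule absolutely_continuous_on_if_dominated[OF absolutely_continuous_on_ident absolutely_continuous_on_ident, of _ _ "max L 0"])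
    fix x y assume "x \<in> {a..b}" "y \<in> {a..b}"
    then have "\<bar>f y - f x\<bar> \<le> L * \<bar>y - x\<bar>"
      using le[of x y] le[of y x] by (cases x y rule: linorder_cases) (auto simp: abs_minus_commute)
    also have "\<dots> \<le> max L 0 * (\<bar>y - x\<bar> + \<bar>y - x\<bar>)"
      by (intro mult_mono) auto
    finally show "norm (f y - f x) \<le> max L 0 * (norm (y - x) + norm (y - x))" by simp
  qed
qed

lemma absolutely_continuous_on_mult:
  fixes f g :: "real \<Rightarrow> real"
  assumes f: "absolutely_continuous_on S f" and g: "absolutely_continuous_on S g"
    and "bounded (f ` S)" "bounded (g ` S)"
  shows "absolutely_continuous_on S (\<lambda>x. f x * g x)"
proof -
  obtain A B where A: "\<And>x. x \<in> S \<Longrightarrow> \<bar>f x\<bar> \<le> A" and B: "\<And>x. x \<in> S \<Longrightarrow> \<bar>g x\<bar> \<le> B"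
    using assms(3,4) unfolding bounded_iff by auto
  show ?thesis
  proof (rule absolutely_continuous_on_if_dominated[OF f g, of _ "max A B"])
    fix x y assume xy: "x \<in> S" "y \<in> S"
    have "\<bar>f y * g y - f x * g x\<bar> = \<bar>g y * (f y - f x) + f x * (g y - g x)\<bar>"
      by (simp add: algebra_simps)
    also have "\<dots> \<le> \<bar>g y\<bar> * \<bar>f y - f x\<bar> + \<bar>f x\<bar> * \<bar>g y - g x\<bar>"
      by (simp flip: abs_mult)
    also have "\<dots> \<le> max A B * \<bar>f y - f x\<bar> + max A B * \<bar>g y - g x\<bar>"
      using A[OF xy(1)] B[OF xy(2)] by (intro add_mono mult_right_mono) auto
    finally show "norm (f y * g y - f x * g x) \<le> max A B * (norm (f y - f x) + norm (g y - g x))"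
      by (simp add: algebra_simps)
  qed
qed

text \<open>With the Henstock--Kurzweil integral it is enough to control Riemann sums, and the gauge is
  chosen separately for tags outside and inside the exceptional set \<open>N\<close>. Outside, it comes from
  differentiability, as in the fundamental theorem for everywhere differentiable functions. Inside,
  it is an open set \<open>U \<supseteq> N\<close> whose measure is below the \<open>\<delta>\<close> of absolute continuity: the intervals
  tagged in \<open>N\<close> then have total length less than \<open>\<delta>\<close>, so they contribute little to the increment of \<open>F\<close>.\<close>

theorem fundamental_theorem_of_calculus_absolutely_continuous:
  fixes F f :: "real \<Rightarrow> real"
  assumes "a \<le> b" and ac: "absolutely_continuous_on {a..b} F" and N: "negligible N"
    and deriv: "\<And>x. x \<in> {a..b} - N \<Longrightarrow> (F has_real_derivative f x) (at x within {a..b})"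
  shows "(f has_integral F b - F a) {a..b}"
proof -
  \<comment> \<open>Changing the integrand to \<open>0\<close> on \<open>N\<close> removes the tags in \<open>N\<close> from the Riemann sums.\<close>
  define f0 where "f0 = (\<lambda>x. if x \<in> N then 0 else f x)"
  have "(f0 has_integral F b - F a) (cbox a b)"
    unfolding has_integral
  proof (intro allI impI)
    fix e :: real assume "e > 0"
    define c where "c = e / (2 * (b - a + 1))"
    have "c > 0" using \<open>e > 0\<close> \<open>a \<le> b\<close> by (simp add: c_def)
    have c_small: "c * (b - a) \<le> e / 2"
      using \<open>e > 0\<close> \<open>a \<le> b\<close> by (simp add: c_def field_simps)
    obtain \<delta> where "\<delta> > 0" and \<delta>: "\<And>d T. \<lbrakk>d division_of T; T \<subseteq> {a..b}; (\<Sum>K\<in>d. Sup K - Inf K) < \<delta>\<rbrakk>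
        \<Longrightarrow> (\<Sum>K\<in>d. norm (F (Sup K) - F (Inf K))) < e / 2"
      using ac \<open>e > 0\<close> unfolding absolutely_continuous_on_def by (metis half_gt_zero)
    obtain U where U: "open U" "N \<subseteq> U" "U - N \<in> lmeasurable" "emeasure lebesgue (U - N) < ennreal \<delta>"
      using sets_lebesgue_outer_open[OF negligible_imp_sets[OF N] \<open>\<delta> > 0\<close>] by blast
    have "U = (U - N) \<union> N" using U(2) by auto
    then have lmU: "U \<in> lmeasurable"
      using U(3) negligible_imp_measurable[OF N] by (metis fmeasurable.Un)
    have "measure lebesgue U = measure lebesgue (U - N)"
      using N by (metis \<open>U = (U - N) \<union> N\<close> measure_Un_null_set negligible_iff_null_sets U(3) fmeasurableD)
    moreover have "measure lebesgue (U - N) < \<delta>"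
      using U(3,4) \<open>\<delta> > 0\<close> by (metis emeasure_eq_measure2 ennreal_less_iff measure_nonneg)
    ultimately have mU: "measure lebesgue U < \<delta>" by simp
    have "\<exists>t>0. x \<in> {a..b} - N \<longrightarrow>
         (\<forall>y\<in>{a..b}. \<bar>y - x\<bar> < t \<longrightarrow> \<bar>F y - F x - (y - x) * f x\<bar> \<le> c * \<bar>y - x\<bar>)" for x
    proof (cases "x \<in> {a..b} - N")
      case True
      then have "(F has_vector_derivative f x) (at x within {a..b})"
        using deriv by (simp add: has_real_derivative_iff_has_vector_derivative)
      then show ?thesis
        using \<open>c > 0\<close> unfolding has_vector_derivative_def has_derivative_within_alt by fastforce
    qed (auto intro: exI[of _ 1])
    then obtain t where t: "\<And>x. t x > 0"
      "\<And>x y. \<lbrakk>x \<in> {a..b} - N; y \<in> {a..b}; \<bar>y - x\<bar> < t x\<rbrakk>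
         \<Longrightarrow> \<bar>F y - F x - (y - x) * f x\<bar> \<le> c * \<bar>y - x\<bar>"
      by metis
    define \<gamma> where "\<gamma> = (\<lambda>x. if x \<in> N then U else ball x (t x))"
    show "\<exists>\<gamma>. gauge \<gamma> \<and> (\<forall>D. D tagged_division_of cbox a b \<and> \<gamma> fine D \<longrightarrow>
        norm ((\<Sum>(x, K)\<in>D. measure lborel K *\<^sub>R f0 x) - (F b - F a)) < e)"
    proof (intro exI[of _ \<gamma>] conjI allI impI)
      show "gauge \<gamma>"
        unfolding gauge_def \<gamma>_def using U t(1) by auto
      fix D assume D: "D tagged_division_of cbox a b \<and> \<gamma> fine D"
      define err where "err = (\<lambda>(x, K). measure lborel K * f0 x - (F (Sup K) - F (Inf K)))"
      have "finite D" using D by auto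
      have incr: "b - a = (\<Sum>(x,K)\<in>D. Sup K - Inf K)" "F b - F a = (\<Sum>(x,K)\<in>D. F (Sup K) - F (Inf K))"
        using additive_tagged_division_1[where f = "\<lambda>x. x" and p = D and a = a and b = b]
          additive_tagged_division_1[where f = F and p = D and a = a and b = b] D \<open>a \<le> b\<close> by auto
      have K_props: "\<exists>u v. K = {u..v} \<and> u \<le> v \<and> Inf K = u \<and> Sup K = v \<and> x \<in> {u..v} \<and> {u..v} \<subseteq> {a..b} \<and> {u..v} \<subseteq> \<gamma> x"
        if xK: "(x, K) \<in> D" for x K
      proof -
        obtain u v where "K = cbox u v" "x \<in> K" "K \<subseteq> cbox a b"
          using D tagged_division_ofD(2,3,4)[OF conjunct1[OF D] xK] by auto
        moreover have "K \<subseteq> \<gamma> x" using D xK by (auto simp: fine_def)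
        ultimately show ?thesis by (intro exI[of _ u] exI[of _ v]) auto
      qed
      define D1 where "D1 = {p \<in> D. fst p \<in> N}"
      define D2 where "D2 = D - D1"
      have sub: "D1 \<subseteq> D" "D2 \<subseteq> D" by (auto simp: D1_def D2_def)
      have fin: "finite D1" "finite D2" using sub \<open>finite D\<close> by (auto intro: finite_subset)
      \<comment> \<open>Off the null set, the increments of \<open>F\<close> are given by its derivative up to \<open>c\<close> times the lengths.\<close>
      have "(\<Sum>p\<in>D2. \<bar>err p\<bar>) \<le> (\<Sum>(x,K)\<in>D2. c * (Sup K - Inf K))"
      proof (rule sum_mono, clarify)
        fix x K assume xK: "(x, K) \<in> D2"
        then obtain u v where K: "K = {u..v}" "u \<le> v" "Inf K = u" "Sup K = v" "x \<in> {u..v}"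
            "{u..v} \<subseteq> {a..b}" "{u..v} \<subseteq> \<gamma> x"
          using K_props sub(2) by blast
        have "x \<notin> N" using xK by (auto simp: D1_def D2_def)
        have near: "\<bar>u - x\<bar> < t x" "\<bar>v - x\<bar> < t x"
          using K \<open>x \<notin> N\<close> subsetD[OF K(7), of u] subsetD[OF K(7), of v]
          by (auto simp: \<gamma>_def dist_real_def abs_minus_commute)
        have "u \<in> {a..b}" "v \<in> {a..b}" "x \<in> {a..b} - N"
          using K \<open>x \<notin> N\<close> subsetD[OF K(6)] by auto
        then have "\<bar>F u - F x - (u - x) * f x\<bar> \<le> c * (x - u)" "\<bar>F v - F x - (v - x) * f x\<bar> \<le> c * (v - x)"
          using t(2)[of x u] t(2)[of x v] near K by auto
        moreover have "err (x, K) = (F u - F x - (u - x) * f x) - (F v - F x - (v - x) * f x)"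
          using \<open>x \<notin> N\<close> K(2) by (simp add: err_def K(1) f0_def algebra_simps)
        ultimately have "\<bar>err (x, K)\<bar> \<le> c * (x - u) + c * (v - x)" by linarith
        then show "\<bar>err (x, K)\<bar> \<le> c * (Sup K - Inf K)"
          using K by (simp add: algebra_simps)
      qed
      also have "\<dots> \<le> (\<Sum>(x,K)\<in>D. c * (Sup K - Inf K))"
      proof (rule sum_mono2[OF \<open>finite D\<close> sub(2)])
        fix p assume "p \<in> D - D2"
        then show "0 \<le> (case p of (x, K) \<Rightarrow> c * (Sup K - Inf K))"
          using K_props[of "fst p" "snd p"] \<open>c > 0\<close> by (cases p) fastforce
      qed
      also have "\<dots> = c * (b - a)"
        unfolding incr(1) by (simp add: sum_distrib_left split_def)
      finally have part2: "(\<Sum>p\<in>D2. \<bar>err p\<bar>) \<le> e / 2" using c_small by linarith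
      \<comment> \<open>The intervals tagged in the null set lie in \<open>U\<close>, hence have small total length.\<close>
      have D1: "D1 tagged_partial_division_of cbox a b"
        using D sub(1) tagged_partial_division_subset unfolding tagged_division_of_def by blast
      then have self: "D1 tagged_division_of \<Union>(snd ` D1)"
        by (rule tagged_partial_division_of_Union_self)
      have div: "snd ` D1 division_of \<Union>(snd ` D1)"
        using D1 by (rule partial_division_of_tagged_division)
      have "\<Union>(snd ` D1) \<subseteq> {a..b}" "\<Union>(snd ` D1) \<subseteq> U"
        using K_props by (fastforce simp: D1_def \<gamma>_def)+
      have "(\<Sum>K\<in>snd ` D1. Sup K - Inf K) = (\<Sum>K\<in>snd ` D1. measure lebesgue K)"
      proof (rule sum.cong[OF refl])
        fix K assume "K \<in> snd ` D1"
        then obtain x where "(x, K) \<in> D" using sub(1) by auto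
        then obtain u v where "K = {u..v}" "u \<le> v" "Inf K = u" "Sup K = v"
          using K_props by blast
        moreover have "measure lebesgue {u..v} = v - u" using \<open>u \<le> v\<close> by simp
        ultimately show "Sup K - Inf K = measure lebesgue K" by metis
      qed
      also have "\<dots> = measure lebesgue (\<Union>(snd ` D1))"
        by (rule content_division[OF div])
      also have "\<dots> \<le> measure lebesgue U"
        by (rule measure_mono_fmeasurable[OF \<open>\<Union>(snd ` D1) \<subseteq> U\<close> _ lmU])
          (use lmeasurable_division[OF div] in auto)
      finally have "(\<Sum>K\<in>snd ` D1. norm (F (Sup K) - F (Inf K))) < e / 2"
        using \<delta>[OF div \<open>\<Union>(snd ` D1) \<subseteq> {a..b}\<close>] mU by linarith
      moreover have "(\<Sum>p\<in>D1. \<bar>err p\<bar>) = (\<Sum>(x,K)\<in>D1. \<bar>F (Sup K) - F (Inf K)\<bar>)"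
        by (rule sum.cong) (auto simp: D1_def err_def f0_def)
      moreover have "(\<Sum>(x,K)\<in>D1. \<bar>F (Sup K) - F (Inf K)\<bar>) = (\<Sum>K\<in>snd ` D1. \<bar>F (Sup K) - F (Inf K)\<bar>)"
      proof -
        \<comment> \<open>Two tags may share a degenerate interval, on which the increment vanishes; so the sum over tagged intervals is the sum over intervals.\<close>
        have "(\<Sum>(x,K)\<in>D1. (if K = {} then 0 else \<bar>F (Sup K) - F (Inf K)\<bar>))
            = (\<Sum>K\<in>snd ` D1. (if K = {} then 0 else \<bar>F (Sup K) - F (Inf K)\<bar>))"
        proof (rule sum.over_tagged_division_lemma[OF self])
          fix u v :: real assume "box u v = {}"
          then have "v \<le> u" by simp
          then show "(if cbox u v = {} then 0 else \<bar>F (Sup (cbox u v)) - F (Inf (cbox u v))\<bar>) = 0"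
            by (cases "u = v") auto
        qed
        moreover have "K \<noteq> {}" if "(x, K) \<in> D1" for x K using K_props that sub(1) by fastforce
        then have "(\<Sum>(x,K)\<in>D1. (if K = {} then 0 else \<bar>F (Sup K) - F (Inf K)\<bar>)) = (\<Sum>(x,K)\<in>D1. \<bar>F (Sup K) - F (Inf K)\<bar>)"
          "(\<Sum>K\<in>snd ` D1. (if K = {} then 0 else \<bar>F (Sup K) - F (Inf K)\<bar>)) = (\<Sum>K\<in>snd ` D1. \<bar>F (Sup K) - F (Inf K)\<bar>)"
          by (intro sum.cong; force)+
        ultimately show ?thesis by simp
      qed
      ultimately have part1: "(\<Sum>p\<in>D1. \<bar>err p\<bar>) < e / 2" by simp
      have "(\<Sum>(x, K)\<in>D. measure lborel K *\<^sub>R f0 x) - (F b - F a) = (\<Sum>p\<in>D. err p)"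
        unfolding incr(2) by (simp add: sum_subtractf[symmetric] err_def split_def)
      also have "\<bar>\<dots>\<bar> \<le> (\<Sum>p\<in>D. \<bar>err p\<bar>)" by (rule sum_abs)
      also have "\<dots> = (\<Sum>p\<in>D1. \<bar>err p\<bar>) + (\<Sum>p\<in>D2. \<bar>err p\<bar>)"
        using sum.subset_diff[OF sub(1) \<open>finite D\<close>, of "\<lambda>p. \<bar>err p\<bar>"] by (simp add: D2_def)
      finally show "norm ((\<Sum>(x, K)\<in>D. measure lborel K *\<^sub>R f0 x) - (F b - F a)) < e"
        using part1 part2 by simp
    qed
  qed
  then have "(f0 has_integral F b - F a) {a..b}" by simp
  then show ?thesis
    by (rule has_integral_spike[OF N, rotated]) (simp add: f0_def)
qed

section \<open>The quadratic functional\<close>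

lemma continuous_on_Icc_imp_bounded:
  fixes f :: "real \<Rightarrow> real"
  shows "continuous_on {a..b} f \<Longrightarrow> bounded (f ` {a..b})"
  by (simp add: compact_continuous_image compact_imp_bounded)

text \<open>The Euler--Lagrange equation of the functional is \<open>(x u'')'' = (u'/x)'\<close>, that is \<open>L0 u = 0\<close>. Its
  first integral \<open>(x u'')' = u'/x - g\<close> is what one integration by parts needs:
  \<open>x u'' k' + (u'/x) k\<close> is the derivative of \<open>x u'' k\<close> plus \<open>g k\<close>, and \<open>g k\<close> integrates to
  \<open>g (h b - h a)\<close>. This vanishes if \<open>g = 0\<close>, and also between two knots, where \<open>h\<close> is zero.\<close>

lemma integration_by_parts_first_variation:
  fixes u1 u2 h k k' :: "real \<Rightarrow> real"
  assumes "0 < a" "a \<le> b"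
    and h: "\<And>x. x \<in> {a..b} \<Longrightarrow> (h has_real_derivative k x) (at x within {a..b})"
    and ac: "absolutely_continuous_on {a..b} k" and contk: "continuous_on {a..b} k"
    and N: "negligible N"
    and k: "\<And>x. x \<in> {a..b} - N \<Longrightarrow> (k has_real_derivative k' x) (at x within {a..b})"
    and contu: "continuous_on {a..b} u1" "continuous_on {a..b} u2"
    and EL: "\<And>x. x \<in> {a<..<b} \<Longrightarrow> ((\<lambda>x. x * u2 x) has_real_derivative u1 x / x - g) (at x)"
    and g: "g * (h b - h a) = 0"
  shows "((\<lambda>x. x * u2 x * k' x + u1 x / x * k x) has_integral b * u2 b * k b - a * u2 a * k a) {a..b}"
proof -
  let ?p = "\<lambda>x. x * u2 x"
  have contp: "continuous_on {a..b} ?p"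
    using contu by (intro continuous_intros)
  have contp': "continuous_on {a..b} (\<lambda>x. u1 x / x - g)"
    using contu \<open>0 < a\<close> by (intro continuous_intros) auto
  have "bounded ((\<lambda>x. u1 x / x - g) ` {a<..<b})"
    by (rule bounded_subset[OF continuous_on_Icc_imp_bounded[OF contp']]) auto
  then have acp: "absolutely_continuous_on {a..b} ?p"
    using contp EL by (intro bounded_derivative_imp_absolutely_continuous_on) auto
  have "absolutely_continuous_on {a..b} (\<lambda>x. ?p x * k x)"
    using absolutely_continuous_on_mult[OF acp ac] contp contk
    by (simp add: continuous_on_Icc_imp_bounded)
  moreover have "negligible (N \<union> {a, b})" using N by simp
  moreover have "((\<lambda>x. ?p x * k x) has_real_derivative (?p x * k' x + (u1 x / x - g) * k x))
      (at x within {a..b})" if "x \<in> {a..b} - (N \<union> {a, b})" for x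
  proof -
    have "(?p has_real_derivative u1 x / x - g) (at x within {a..b})"
      by (rule has_field_derivative_at_within, rule EL) (use that in auto)
    moreover have "(k has_real_derivative k' x) (at x within {a..b})"
      using that by (intro k) auto
    ultimately show ?thesis
      using DERIV_mult[of ?p "u1 x / x - g" x "{a..b}" k "k' x"] by (simp add: algebra_simps)
  qed
  ultimately have 1: "((\<lambda>x. ?p x * k' x + (u1 x / x - g) * k x) has_integral ?p b * k b - ?p a * k a) {a..b}"
    using \<open>a \<le> b\<close> by (intro fundamental_theorem_of_calculus_absolutely_continuous)
  have "(k has_integral h b - h a) {a..b}"
    using \<open>a \<le> b\<close> h by (intro fundamental_theorem_of_calculus)
      (auto simp: has_real_derivative_iff_has_vector_derivative)
  then have "((\<lambda>x. g * k x) has_integral g * (h b - h a)) {a..b}"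
    by (rule has_integral_mult_right)
  from has_integral_add[OF 1 this[unfolded g]] show ?thesis
    by (simp add: algebra_simps)
qed

text \<open>The two terms of the energy density dominate \<open>(k\<^sup>2)' = 2 k k'\<close> by the arithmetic-geometric mean
  inequality, so the oscillation of \<open>k\<^sup>2\<close> is at most \<open>E\<close>; and \<open>k\<^sup>2 / x\<close> has integral at most \<open>E\<close>, so
  \<open>k\<^sup>2\<close> cannot exceed \<open>2 E\<close> throughout. The constant is the same for all intervals with \<open>R2 \<ge> 2 R1\<close>.\<close>

lemma sup_bound_of_energy:
  fixes k k' :: "real \<Rightarrow> real"
  assumes R: "0 < R1" "2 * R1 \<le> R2"
    and ac: "absolutely_continuous_on {R1..R2} k" and contk: "continuous_on {R1..R2} k"
    and N: "negligible N"
    and k: "\<And>x. x \<in> {R1..R2} - N \<Longrightarrow> (k has_real_derivative k' x) (at x within {R1..R2})"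
    and E: "((\<lambda>x. x * (k' x)\<^sup>2 + (k x)\<^sup>2 / x) has_integral E) {R1..R2}"
    and x: "x \<in> {R1..R2}"
  shows "(k x)\<^sup>2 \<le> 3 * E"
proof -
  let ?F = "\<lambda>x. x * (k' x)\<^sup>2 + (k x)\<^sup>2 / x"
  have "R1 < R2" using R by simp
  have pos: "0 \<le> ?F z" if "z \<in> {R1..R2}" for z using that R by auto
  have young: "\<bar>2 * k z * k' z\<bar> \<le> ?F z" if "z \<in> {R1..R2}" for z
  proof -
    have z: "z > 0" using that R by auto
    have "0 \<le> (z * k' z - k z)\<^sup>2 / z" "0 \<le> (z * k' z + k z)\<^sup>2 / z" using z by auto
    moreover have "(z * k' z - k z)\<^sup>2 / z = ?F z - 2 * k z * k' z"
      "(z * k' z + k z)\<^sup>2 / z = ?F z + 2 * k z * k' z"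
      using z by (auto simp: field_simps power2_eq_square)
    ultimately show ?thesis by linarith
  qed
  have osc_le: "\<bar>(k z)\<^sup>2 - (k y)\<^sup>2\<bar> \<le> E" if yz: "R1 \<le> y" "y \<le> z" "z \<le> R2" for y z
  proof -
    have sub: "{y..z} \<subseteq> {R1..R2}" using yz by auto
    have "absolutely_continuous_on {R1..R2} (\<lambda>x. k x * k x)"
      using ac contk by (intro absolutely_continuous_on_mult continuous_on_Icc_imp_bounded)
    then have "absolutely_continuous_on {y..z} (\<lambda>x. k x * k x)"
      using sub by (rule absolutely_continuous_on_subset)
    moreover have "((\<lambda>x. k x * k x) has_real_derivative 2 * k w * k' w) (at w within {y..z})"
      if "w \<in> {y..z} - N" for w
    proof -
      have "(k has_real_derivative k' w) (at w within {y..z})"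
        using k[of w] that sub by (intro DERIV_subset[OF _ sub]) auto
      from DERIV_mult[OF this this] show ?thesis by (simp add: mult.assoc)
    qed
    ultimately have 1: "((\<lambda>w. 2 * k w * k' w) has_integral k z * k z - k y * k y) {y..z}"
      using yz N by (intro fundamental_theorem_of_calculus_absolutely_continuous)
    have int: "?F integrable_on {y..z}"
      using E sub by (meson has_integral_integrable integrable_on_subinterval)
    have "integral {y..z} ?F \<le> integral {R1..R2} ?F"
      using E sub pos int by (intro integral_subset_le) (auto dest: has_integral_integrable)
    then have "integral {y..z} ?F \<le> E" using E integral_unique by blast
    moreover have "\<bar>k z * k z - k y * k y\<bar> \<le> integral {y..z} ?F"
      using integral_norm_bound_integral[OF has_integral_integrable[OF 1] int] young sub
      by (auto simp: integral_unique[OF 1])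
    ultimately show ?thesis by (simp add: power2_eq_square)
  qed
  have osc: "(k x)\<^sup>2 - E \<le> (k y)\<^sup>2" if "y \<in> {R1..R2}" for y
  proof (cases "x \<le> y")
    case True
    then have "\<bar>(k y)\<^sup>2 - (k x)\<^sup>2\<bar> \<le> E" using osc_le that x by auto
    then show ?thesis by linarith
  next
    case False
    then have "\<bar>(k x)\<^sup>2 - (k y)\<^sup>2\<bar> \<le> E" using osc_le that x by auto
    then show ?thesis by linarith
  qed
  have "E \<ge> 0" using has_integral_nonneg[OF E] pos by blast
  show ?thesis
  proof (cases "(k x)\<^sup>2 \<le> E")
    case True then show ?thesis using \<open>E \<ge> 0\<close> by linarith
  next
    case False
    define m where "m = (k x)\<^sup>2 - E"
    have "m > 0" using False by (simp add: m_def)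
    \<comment> \<open>Here \<open>k\<^sup>2 \<ge> m\<close> everywhere, and \<open>m (R2 - R1) / R2 \<ge> m / 2\<close> because \<open>R2 \<ge> 2 R1\<close>.\<close>
    have "((\<lambda>_. m / R2) has_integral (R2 - R1) *\<^sub>R (m / R2)) {R1..R2}"
      using has_integral_const_real[of "m / R2" R1 R2] \<open>R1 < R2\<close> by simp
    then have "(R2 - R1) *\<^sub>R (m / R2) \<le> E"
    proof (rule has_integral_le[OF _ E])
      fix y assume y: "y \<in> {R1..R2}"
      have "m / R2 \<le> (k y)\<^sup>2 / y"
        using osc[OF y] y R \<open>m > 0\<close> by (intro frac_le) (auto simp: m_def)
      also have "\<dots> \<le> ?F y" using y R by auto
      finally show "m / R2 \<le> ?F y" .
    qed
    moreover have "m / 2 \<le> (R2 - R1) *\<^sub>R (m / R2)"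
      using R \<open>m > 0\<close> by (simp add: field_simps)
    ultimately have "m / 2 \<le> E" by linarith
    then show ?thesis by (simp add: m_def)
  qed
qed

section \<open>Admissible functions\<close>

lemma admissibleD:
  assumes f: "f \<in> admissible a b" and f': "f' = vderiv {a..b} f" and f'': "f'' = vderiv {a..b} f'"
  shows "\<And>x. x \<in> {a..b} \<Longrightarrow> f differentiable (at x within {a..b})"
    and "continuous_on {a..b} f'"
    and "absolutely_continuous_on {a..b} f'"
    and "AE x in lebesgue_on {a..b}. f' differentiable (at x within {a..b})"
    and "integrable (lebesgue_on {a..b}) (\<lambda>x. \<bar>f'' x\<bar>\<^sup>2)"
  using f unfolding admissible_def Let_def mem_Collect_eq f'' f' by blast+

lemma admissible_imp_has_derivative:
  assumes f: "f \<in> admissible a b" and "a < b" and f': "f' = vderiv {a..b} f"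
    and f'': "f'' = vderiv {a..b} f'"
  shows "\<And>x. x \<in> {a..b} \<Longrightarrow> (f has_real_derivative f' x) (at x within {a..b})"
    and "\<exists>N. negligible N \<and> (\<forall>x\<in>{a..b} - N. (f' has_real_derivative f'' x) (at x within {a..b}))"
proof -
  show "(f has_real_derivative f' x) (at x within {a..b})" if "x \<in> {a..b}" for x
  proof -
    have "f differentiable (at x within {a..b})"
      using admissibleD(1)[OF f f' f''] that by blast
    then show ?thesis
      using f' by (simp add: has_real_derivative_iff_has_vector_derivative vector_derivative_works vderiv_def)
  qed
  note admissibleD(4)[OF f f' f'']
  then have "AE x in lebesgue. x \<in> {a..b} \<longrightarrow> f' differentiable (at x within {a..b})"
    by (simp add: AE_restrict_space_iff)
  then obtain N where N: "negligible N"
      "{x. \<not> (x \<in> {a..b} \<longrightarrow> f' differentiable (at x within {a..b}))} \<subseteq> N"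
    unfolding eventually_ae_filter_negligible by auto
  show "\<exists>N. negligible N \<and> (\<forall>x\<in>{a..b} - N. (f' has_real_derivative f'' x) (at x within {a..b}))"
  proof (intro exI[of _ N] conjI ballI N)
    fix x assume "x \<in> {a..b} - N"
    then have "f' differentiable (at x within {a..b})" using N(2) by auto
    then show "(f' has_real_derivative f'' x) (at x within {a..b})"
      using f'' by (simp add: has_real_derivative_iff_has_vector_derivative vector_derivative_works vderiv_def)
  qed
qed

lemma admissible_energy_has_integral:
  assumes f: "f \<in> admissible a b" and f': "f' = vderiv {a..b} f" and f'': "f'' = vderiv {a..b} f'"
    and "0 < a"
  shows "((\<lambda>x. x * (f'' x)\<^sup>2 + (f' x)\<^sup>2 / x) has_integral energy a b f) {a..b}"
proof -
  have iff: "integrable (lebesgue_on {a..b}) g \<longleftrightarrow> g absolutely_integrable_on {a..b}" for g :: "real \<Rightarrow> real"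
    unfolding set_integrable_def by (rule integrable_restrict_space) simp
  note admissibleD(5)[OF f f' f'']
  then have "(\<lambda>x. \<bar>f'' x\<bar>\<^sup>2) absolutely_integrable_on {a..b}"
    unfolding iff .
  moreover have "(\<lambda>x. x) \<in> borel_measurable (lebesgue_on {a..b})"
    by (intro continuous_imp_measurable_on_sets_lebesgue continuous_on_id) auto
  moreover have "bounded ((\<lambda>x. x) ` {a..b})"
    by (intro continuous_on_Icc_imp_bounded continuous_on_id)
  ultimately have "(\<lambda>x. x * \<bar>f'' x\<bar>\<^sup>2) absolutely_integrable_on {a..b}"
    by (intro absolutely_integrable_bounded_measurable_product_real) auto
  then have 1: "integrable (lebesgue_on {a..b}) (\<lambda>x. x * \<bar>f'' x\<bar>\<^sup>2)"
    unfolding iff .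
  note admissibleD(2)[OF f f' f'']
  then have 2: "integrable (lebesgue_on {a..b}) (\<lambda>x. 1 / x * \<bar>f' x\<bar>\<^sup>2)"
    using \<open>0 < a\<close> by (intro continuous_imp_integrable_real continuous_intros) auto
  show ?thesis
    using has_integral_integral_lebesgue_on[OF Bochner_Integration.integrable_add[OF 1 2]]
    by (simp add: energy_def Let_def f' f'')
qed

text \<open>A spline is a competitor for the minimizer, and its energy may be computed from its ordinary
  derivatives, which agree with the one-sided derivatives at the endpoints of the interval.\<close>

lemma C2_imp_admissible:
  assumes "a < b"
    and u: "\<And>x. x \<in> {a..b} \<Longrightarrow> (u has_real_derivative u1 x) (at x)"
    and u1: "\<And>x. x \<in> {a..b} \<Longrightarrow> (u1 has_real_derivative u2 x) (at x)"
    and u2: "continuous_on {a..b} u2"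
  shows "u \<in> admissible a b"
    and "\<And>x. x \<in> {a..b} \<Longrightarrow> vderiv {a..b} u x = u1 x"
    and "\<And>x. x \<in> {a..b} \<Longrightarrow> vderiv {a..b} (vderiv {a..b} u) x = u2 x"
proof -
  define w where "w = vderiv {a..b} u"
  have w: "w x = u1 x" if "x \<in> {a..b}" for x
    unfolding w_def vderiv_def
    using u[OF that] that \<open>a < b\<close> vector_derivative_at_within_ivl[of u "u1 x" x a b]
    by (simp add: has_real_derivative_iff_has_vector_derivative)
  have w': "(w has_real_derivative u2 x) (at x within {a..b})" if "x \<in> {a..b}" for x
    unfolding has_real_derivative_iff_has_vector_derivative
    by (rule has_vector_derivative_transform[OF that w])
      (use u1[OF that] in \<open>auto simp: has_real_derivative_iff_has_vector_derivative
        intro: has_vector_derivative_at_within\<close>)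
  have w'': "vderiv {a..b} w x = u2 x" if "x \<in> {a..b}" for x
    unfolding vderiv_def
    using vector_derivative_within_closed_interval[OF \<open>a < b\<close> that] w'[OF that]
    by (simp add: has_real_derivative_iff_has_vector_derivative)
  show "\<And>x. x \<in> {a..b} \<Longrightarrow> vderiv {a..b} u x = u1 x"
    "\<And>x. x \<in> {a..b} \<Longrightarrow> vderiv {a..b} (vderiv {a..b} u) x = u2 x"
    using w w'' by (auto simp: w_def)
  have contw: "continuous_on {a..b} w"
    using w' by (rule DERIV_continuous_on)
  have "absolutely_continuous_on {a..b} w"
  proof (rule bounded_derivative_imp_absolutely_continuous_on[OF contw])
    fix x assume "x \<in> {a<..<b}"
    then show "(w has_real_derivative u2 x) (at x)"
      using w'[of x] by (simp add: at_within_Icc_at)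
  next
    show "bounded (u2 ` {a<..<b})"
      by (rule bounded_subset[OF continuous_on_Icc_imp_bounded[OF u2]]) auto
  qed
  moreover have "w differentiable (at x within {a..b})" "u differentiable (at x within {a..b})"
    if "x \<in> {a..b}" for x
    using w'[OF that] u[OF that]
    by (auto simp: real_differentiable_def intro: has_field_derivative_at_within)
  moreover have contw'': "continuous_on {a..b} (vderiv {a..b} w)"
    using continuous_on_eq[OF u2] w'' by metis
  moreover have "vderiv {a..b} w \<in> borel_measurable (lebesgue_on {a..b})"
    using contw'' by (intro continuous_imp_measurable_on_sets_lebesgue) auto
  moreover have "integrable (lebesgue_on {a..b}) (\<lambda>x. \<bar>vderiv {a..b} w x\<bar>\<^sup>2)"
    using contw'' by (intro continuous_imp_integrable_real continuous_intros)
  ultimately show "u \<in> admissible a b"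
    using contw unfolding admissible_def Let_def mem_Collect_eq w_def[symmetric]
    by (intro conjI) (auto intro: AE_I2)
qed

section \<open>Comparison of the spline with a minimizer\<close>

text \<open>What the argument uses of a real-valued non-singular spline \<open>u\<close> with derivatives \<open>u1\<close>, \<open>u2\<close>.
  Between knots, \<open>L0 u = 0\<close> is encoded by its first integral, the form in which integration by parts
  uses it. Before the first knot, \<open>u\<close> is \<open>a x\<^sup>2 / 2\<close> up to a constant, and after the last knot it is
  \<open>d ln x\<close> up to a constant.\<close>

definition real_spline_data ::
    "nat \<Rightarrow> (nat \<Rightarrow> real) \<Rightarrow> real \<Rightarrow> real \<Rightarrow> (real \<Rightarrow> real) \<Rightarrow> (real \<Rightarrow> real) \<Rightarrow> (real \<Rightarrow> real) \<Rightarrow> bool" where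
  "real_spline_data n r a d u u1 u2 \<longleftrightarrow>
     (\<forall>x>0. (u has_real_derivative u1 x) (at x) \<and> (u1 has_real_derivative u2 x) (at x) \<and> isCont u2 x) \<and>
     (\<forall>j\<in>{1..<n}. \<exists>g. \<forall>x\<in>{r j<..<r (Suc j)}.
        ((\<lambda>x. x * u2 x) has_real_derivative u1 x / x - g) (at x)) \<and>
     (\<forall>x\<in>{0<..<r 1}. u1 x = a * x \<and> u2 x = a) \<and>
     (\<forall>x>r n. u1 x = d / x \<and> u2 x = - (d / x\<^sup>2))"

text \<open>On the two outer intervals the constant \<open>g\<close> of the first integral is zero: this holds for \<open>x\<^sup>2\<close> and
  for \<open>ln x\<close>. The contributions of the pieces telescope because \<open>u2\<close> is continuous at the knots, and only
  the boundary terms at \<open>R1\<close> and \<open>R2\<close> survive.\<close>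

lemma first_variation_spline:
  fixes h k k' :: "real \<Rightarrow> real"
  assumes u: "real_spline_data n r a d u u1 u2"
    and n: "n \<ge> 1" and r: "strict_mono_on {1..n} r" and R: "0 < R1" "R1 < r 1" "r n < R2"
    and h: "\<And>x. x \<in> {R1..R2} \<Longrightarrow> (h has_real_derivative k x) (at x within {R1..R2})"
    and ac: "absolutely_continuous_on {R1..R2} k" and contk: "continuous_on {R1..R2} k"
    and N: "negligible N"
    and k: "\<And>x. x \<in> {R1..R2} - N \<Longrightarrow> (k has_real_derivative k' x) (at x within {R1..R2})"
    and knots: "\<And>j. j \<in> {1..n} \<Longrightarrow> h (r j) = 0"
  shows "((\<lambda>x. x * u2 x * k' x + u1 x / x * k x) has_integral
           - (d / R2) * k R2 - a * R1 * k R1) {R1..R2}"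
proof -
  let ?f = "\<lambda>x. x * u2 x * k' x + u1 x / x * k x"
  have piece: "(?f has_integral y * u2 y * k y - x * u2 x * k x) {x..y}"
    if xy: "R1 \<le> x" "x \<le> y" "y \<le> R2"
      and EL: "\<And>z. z \<in> {x<..<y} \<Longrightarrow> ((\<lambda>x. x * u2 x) has_real_derivative u1 z / z - g) (at z)"
      and g: "g * (h y - h x) = 0" for x y g
  proof -
    have sub: "{x..y} \<subseteq> {R1..R2}" using xy by auto
    have "isCont u1 z" "isCont u2 z" if "z > 0" for z
      using u that by (auto simp: real_spline_data_def intro: DERIV_isCont)
    then have "continuous_on {x..y} u2" "continuous_on {x..y} u1"
      using xy R by (auto intro!: continuous_at_imp_continuous_on)
    moreover have "(h has_real_derivative k z) (at z within {x..y})" if "z \<in> {x..y}" for z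
      using h[of z] sub that by (intro DERIV_subset[OF _ sub]) auto
    moreover have "(k has_real_derivative k' z) (at z within {x..y})" if "z \<in> {x..y} - N" for z
      using k[of z] sub that by (intro DERIV_subset[OF _ sub]) auto
    ultimately show ?thesis
      using xy R(1) N EL g continuous_on_subset[OF contk sub] absolutely_continuous_on_subset[OF ac sub]
      by (intro integration_by_parts_first_variation[where h = h and g = g and N = N]) auto
  qed
  have mono: "r i \<le> r j" if "i \<le> j" "i \<in> {1..n}" "j \<in> {1..n}" for i j
    using strict_mono_onD[OF r] that by (cases "i = j") (auto simp: less_le)
  have upto: "(?f has_integral r j * u2 (r j) * k (r j) - R1 * u2 R1 * k R1) {R1..r j}"
    if "1 \<le> j" "j \<le> n" for j
    using that
  proof (induction j rule: dec_induct)
    case base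
    have "((\<lambda>x. x * u2 x) has_real_derivative u1 z / z - 0) (at z)" if z: "z \<in> {R1<..<r 1}" for z
    proof -
      have "((\<lambda>x. x * a) has_real_derivative a) (at z)"
        by (auto intro!: derivative_eq_intros)
      moreover have "a = u1 z / z - 0" using u z R by (auto simp: real_spline_data_def)
      moreover have "\<forall>x\<in>{R1<..<r 1}. x * a = x * u2 x" using u R by (auto simp: real_spline_data_def)
      ultimately show ?thesis
        using has_field_derivative_transform_within_open[of "\<lambda>x. x * a" a z "{R1<..<r 1}"] z by auto
    qed
    then show ?case
      using R mono[of 1 n] n by (intro piece[where g = 0]) auto
  next
    case (step j)
    then have "j \<in> {1..<n}" by auto
    then obtain g where g: "\<forall>x\<in>{r j<..<r (Suc j)}.
        ((\<lambda>x. x * u2 x) has_real_derivative u1 x / x - g) (at x)"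
      using u unfolding real_spline_data_def by blast
    have le: "R1 \<le> r j" "r j \<le> r (Suc j)" "r (Suc j) \<le> R2"
      using mono[of 1 j] mono[of j "Suc j"] mono[of "Suc j" n] R step.hyps step.prems by auto
    have "(?f has_integral r (Suc j) * u2 (r (Suc j)) * k (r (Suc j)) - r j * u2 (r j) * k (r j)) {r j..r (Suc j)}"
      using le g knots[of j] knots[of "Suc j"] step.hyps step.prems
      by (intro piece[where g = g]) auto
    from has_integral_combine[OF le(1,2) step.IH this] step.prems show ?case by simp
  qed
  have "((\<lambda>x. x * u2 x) has_real_derivative u1 z / z - 0) (at z)" if z: "z \<in> {r n<..<R2}" for z
  proof -
    have "0 < r n" using mono[of 1 n] R n by auto
    then have "z > 0" using z by auto
    then have "((\<lambda>x. - (d / x)) has_real_derivative d / z\<^sup>2) (at z)"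
      by (auto intro!: derivative_eq_intros simp: power2_eq_square)
    moreover have "d / z\<^sup>2 = u1 z / z - 0" using u z by (auto simp: real_spline_data_def power2_eq_square)
    moreover have "\<forall>x\<in>{r n<..<R2}. - (d / x) = x * u2 x"
      using u \<open>0 < r n\<close> by (auto simp: real_spline_data_def power2_eq_square)
    ultimately show ?thesis
      using has_field_derivative_transform_within_open[of "\<lambda>x. - (d / x)" "d / z\<^sup>2" z "{r n<..<R2}"] z by auto
  qed
  then have last: "(?f has_integral R2 * u2 R2 * k R2 - r n * u2 (r n) * k (r n)) {r n..R2}"
    using R mono[of 1 n] n by (intro piece[where g = 0]) auto
  have le: "R1 \<le> r n" "r n \<le> R2" using R mono[of 1 n] n by auto
  have ends: "u2 R1 = a" "R2 * u2 R2 = - (d / R2)"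
    using u R le by (auto simp: real_spline_data_def power2_eq_square)
  have "r n * u2 (r n) * k (r n) - R1 * u2 R1 * k R1 + (R2 * u2 R2 * k R2 - r n * u2 (r n) * k (r n))
      = - (d / R2) * k R2 - a * R1 * k R1"
    unfolding ends by simp
  with has_integral_combine[OF le upto[OF n order_refl] last] show ?thesis by (simp only:)
qed

text \<open>Let \<open>h = s - u\<close>. The energy inequality and the expansion of the quadratic energy give \<open>E \<le> - 2 B\<close>, where \<open>E\<close>
  is the energy of \<open>h\<close> and \<open>B\<close> the first variation of the energy at \<open>u\<close> in direction \<open>h\<close>. Since \<open>B\<close> is
  linear in \<open>h'\<close> with small coefficients and \<open>h'\<close> is bounded by the square root of \<open>3 E\<close>, this bounds
  \<open>h'\<close> itself; as \<open>h\<close> vanishes at the first knot, it bounds \<open>h\<close>.\<close>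

lemma distance_to_spline_le:
  assumes u: "real_spline_data n r a d u u1 u2"
    and n: "n \<ge> 1" and r: "strict_mono_on {1..n} r"
    and R: "0 < R1" "R1 < r 1" "r n < R2" "2 * R1 \<le> R2"
    and s: "s \<in> admissible R1 R2" and knots: "\<And>j. j \<in> {1..n} \<Longrightarrow> s (r j) = u (r j)"
    and le: "energy R1 R2 s \<le> energy R1 R2 u"
    and x: "x \<in> {R1..R2}"
  shows "\<bar>s x - u x\<bar> \<le> 6 * (\<bar>d\<bar> / R2 + \<bar>a\<bar> * R1) * \<bar>x - r 1\<bar>"
proof -
  have "R1 < R2" using R by simp
  define s1 where "s1 = vderiv {R1..R2} s"
  define s2 where "s2 = vderiv {R1..R2} s1"
  define h where "h = (\<lambda>x. s x - u x)"
  define k where "k = (\<lambda>x. s1 x - u1 x)"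
  define k' where "k' = (\<lambda>x. s2 x - u2 x)"
  have ud: "(u has_real_derivative u1 x) (at x)" "(u1 has_real_derivative u2 x) (at x)" "isCont u2 x"
    if "x \<in> {R1..R2}" for x
    using u that R by (auto simp: real_spline_data_def)
  have contu2: "continuous_on {R1..R2} u2"
    using ud(3) by (intro continuous_at_imp_continuous_on) auto
  note ua = C2_imp_admissible[OF \<open>R1 < R2\<close> ud(1,2) contu2]
  note sd = admissible_imp_has_derivative[OF s \<open>R1 < R2\<close> s1_def s2_def]
  obtain N where N: "negligible N"
    and s2: "\<And>x. x \<in> {R1..R2} - N \<Longrightarrow> (s1 has_real_derivative s2 x) (at x within {R1..R2})"
    using sd(2) by blast
  have h: "(h has_real_derivative k x) (at x within {R1..R2})" if "x \<in> {R1..R2}" for x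
    unfolding h_def k_def
    by (rule DERIV_diff[OF sd(1)[OF that] has_field_derivative_at_within[OF ud(1)[OF that]]])
  have k: "(k has_real_derivative k' x) (at x within {R1..R2})" if "x \<in> {R1..R2} - N" for x
    unfolding k_def k'_def using that
    by (intro DERIV_diff[OF s2 has_field_derivative_at_within[OF ud(2)]]) auto
  have s1: "continuous_on {R1..R2} s1" "absolutely_continuous_on {R1..R2} s1"
    by (rule admissibleD[OF s s1_def s2_def])+
  have contu1: "continuous_on {R1..R2} u1"
    using ud(2)[THEN DERIV_isCont] by (intro continuous_at_imp_continuous_on) auto
  have contk: "continuous_on {R1..R2} k"
    unfolding k_def using s1(1) contu1 by (intro continuous_intros)
  have "absolutely_continuous_on {R1..R2} u1"
    using contu1 by (rule bounded_derivative_imp_absolutely_continuous_on[where f' = u2])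
      (use ud(2) in \<open>auto intro: bounded_subset[OF continuous_on_Icc_imp_bounded[OF contu2]]\<close>)
  then have ack: "absolutely_continuous_on {R1..R2} k"
    unfolding k_def using s1(2) by (intro absolutely_continuous_on_diff)
  define B where "B = - (d / R2) * k R2 - a * R1 * k R1"
  have B: "((\<lambda>x. x * u2 x * k' x + u1 x / x * k x) has_integral B) {R1..R2}"
    unfolding B_def
    by (rule first_variation_spline[OF u n r R(1-3) h ack contk N k])
      (use knots in \<open>auto simp: h_def\<close>)
  have Es: "((\<lambda>x. x * (s2 x)\<^sup>2 + (s1 x)\<^sup>2 / x) has_integral energy R1 R2 s) {R1..R2}"
    by (rule admissible_energy_has_integral[OF s s1_def s2_def R(1)])
  have Eu: "((\<lambda>x. x * (u2 x)\<^sup>2 + (u1 x)\<^sup>2 / x) has_integral energy R1 R2 u) {R1..R2}"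
    by (rule has_integral_eq[OF _ admissible_energy_has_integral[OF ua(1) refl refl R(1)]])
      (use ua in auto)
  define E where "E = energy R1 R2 s - energy R1 R2 u - 2 * B"
  \<comment> \<open>Expand the square: the energy of \<open>s = u + h\<close> is that of \<open>u\<close>, plus twice the first variation, plus that of \<open>h\<close>.\<close>
  have "((\<lambda>x. (x * (s2 x)\<^sup>2 + (s1 x)\<^sup>2 / x) - (x * (u2 x)\<^sup>2 + (u1 x)\<^sup>2 / x)
      - 2 * (x * u2 x * k' x + u1 x / x * k x)) has_integral E) {R1..R2}"
    unfolding E_def by (intro has_integral_diff has_integral_mult_right Es Eu B)
  then have E: "((\<lambda>x. x * (k' x)\<^sup>2 + (k x)\<^sup>2 / x) has_integral E) {R1..R2}"
  proof (rule has_integral_eq[rotated])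
    fix x assume "x \<in> {R1..R2}"
    then have "x > 0" using R by auto
    then show "(x * (s2 x)\<^sup>2 + (s1 x)\<^sup>2 / x) - (x * (u2 x)\<^sup>2 + (u1 x)\<^sup>2 / x)
      - 2 * (x * u2 x * k' x + u1 x / x * k x) = x * (k' x)\<^sup>2 + (k x)\<^sup>2 / x"
      by (simp add: k_def k'_def power2_eq_square field_simps)
  qed
  have ksq: "(k x)\<^sup>2 \<le> 3 * E" if "x \<in> {R1..R2}" for x
    by (rule sup_bound_of_energy[OF R(1,4) ack contk N k E that])
  define t where "t = \<bar>d\<bar> / R2 + \<bar>a\<bar> * R1"
  have "t \<ge> 0" using R \<open>R1 < R2\<close> by (simp add: t_def)
  define M where "M = sqrt (3 * E)"
  have "(k R1)\<^sup>2 \<le> 3 * E" using ksq \<open>R1 < R2\<close> by simp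
  then have "E \<ge> 0" using zero_le_power2[of "k R1"] by linarith
  have kM: "\<bar>k x\<bar> \<le> M" if "x \<in> {R1..R2}" for x
    unfolding M_def using ksq[OF that] by (metis real_sqrt_abs real_sqrt_le_mono)
  have "- B = d / R2 * k R2 + a * R1 * k R1" by (simp add: B_def)
  also have "\<dots> \<le> \<bar>d / R2 * k R2\<bar> + \<bar>a * R1 * k R1\<bar>" by (intro add_mono abs_ge_self)
  also have "\<dots> = \<bar>d\<bar> / R2 * \<bar>k R2\<bar> + \<bar>a\<bar> * R1 * \<bar>k R1\<bar>"
    using R \<open>R1 < R2\<close> by (simp add: abs_mult)
  also have "\<dots> \<le> \<bar>d\<bar> / R2 * M + \<bar>a\<bar> * R1 * M"
    using R \<open>R1 < R2\<close> by (intro add_mono mult_left_mono kM) auto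
  finally have "- B \<le> t * M" by (simp add: t_def algebra_simps)
  then have "E \<le> 2 * (t * M)" using le by (simp add: E_def)
  moreover have MM: "M * M = 3 * E" using \<open>E \<ge> 0\<close> by (simp add: M_def)
  ultimately have "M * M \<le> 6 * t * M" by linarith
  moreover have "M \<ge> 0" using \<open>E \<ge> 0\<close> by (simp add: M_def)
  ultimately have M: "M \<le> 6 * t" using \<open>t \<ge> 0\<close> by (cases "M = 0") auto
  have "r 1 \<le> r n" using strict_mono_onD[OF r, of 1 n] n by (cases "n = 1") (auto simp: less_le)
  then have "r 1 \<in> {R1..R2}" using R by auto
  have "norm (h x - h (r 1)) \<le> (6 * t) * norm (x - r 1)"
  proof (rule field_differentiable_bound[of "{R1..R2}" h k])
    fix z assume "z \<in> {R1..R2}"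
    then show "(h has_real_derivative k z) (at z within {R1..R2})" "norm (k z) \<le> 6 * t"
      using h kM[of z] M by auto
  qed (use x \<open>r 1 \<in> {R1..R2}\<close> in auto)
  moreover have "h (r 1) = 0" using knots[of 1] n by (simp add: h_def)
  ultimately show ?thesis by (simp add: h_def t_def)
qed

text \<open>Stated for interpolants with no more energy than \<open>u\<close>, so that it applies to the minimizers, with
  \<open>u\<close> the real part of the spline, and equally to \<open>s = 0\<close>, with \<open>u\<close> its imaginary part.\<close>

lemma tendsto_spline:
  assumes u: "real_spline_data n r a d u u1 u2"
    and n: "n \<ge> 1" and r: "strict_mono_on {1..n} r" and "0 < r 1"
    and s: "\<And>R1 R2. \<lbrakk>0 < R1; R1 < r 1; r n < R2\<rbrakk> \<Longrightarrow>
      s R1 R2 \<in> admissible R1 R2 \<and> (\<forall>j\<in>{1..n}. s R1 R2 (r j) = u (r j)) \<and>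
      energy R1 R2 (s R1 R2) \<le> energy R1 R2 u"
    and "x > 0"
  shows "((\<lambda>(R1, R2). s R1 R2 x) \<longlongrightarrow> u x) (at_right 0 \<times>\<^sub>F at_top)"
proof -
  let ?F = "at_right (0::real) \<times>\<^sub>F (at_top :: real filter)"
  let ?b = "\<lambda>p. 6 * (\<bar>d\<bar> / snd p + \<bar>a\<bar> * fst p) * \<bar>x - r 1\<bar>"
  have "eventually (\<lambda>R1. R1 \<in> {0<..<min (r 1) x}) (at_right 0)"
    using \<open>0 < r 1\<close> \<open>x > 0\<close> by (intro eventually_at_right_real) auto
  then have "eventually (\<lambda>p. fst p \<in> {0<..<min (r 1) x} \<and> snd p > max (max (r n) x) (2 * r 1)) ?F"
    by (intro eventually_prodI eventually_gt_at_top)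
  then have bound: "eventually (\<lambda>p. norm (s (fst p) (snd p) x - u x) \<le> ?b p) ?F"
  proof eventually_elim
    case (elim p)
    then have "0 < fst p" "fst p < r 1" "r n < snd p" "2 * fst p \<le> snd p" "x \<in> {fst p..snd p}"
      by auto
    with s[of "fst p" "snd p"] show ?case
      by (simp only: real_norm_def) (intro distance_to_spline_le[OF u n r], auto)
  qed
  have fst: "(fst \<longlongrightarrow> 0) ?F"
    by (rule filterlim_mono[OF filterlim_fst at_within_le_nhds order_refl])
  have snd: "filterlim snd at_infinity ?F"
    by (rule filterlim_at_top_imp_at_infinity[OF filterlim_snd])
  have "(?b \<longlongrightarrow> 6 * (0 + \<bar>a\<bar> * 0) * \<bar>x - r 1\<bar>) ?F"
    by (intro tendsto_intros fst tendsto_divide_0[OF tendsto_const snd])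
  then have "(?b \<longlongrightarrow> 0) ?F" by simp
  from Lim_null_comparison[OF bound this]
  have "((\<lambda>p. s (fst p) (snd p) x) \<longlongrightarrow> u x) ?F" by (rule LIM_zero_cancel)
  then show ?thesis by (simp add: case_prod_unfold)
qed

section \<open>Real components of a Beppo Levi spline\<close>

lemma nderiv_has_vector_derivative:
  assumes "times_differentiable_on m S f" "k < m" "x \<in> S"
  shows "(nderiv k f has_vector_derivative nderiv (Suc k) f x) (at x)"
  using assms by (simp add: times_differentiable_on_def nderiv_def vderiv_def vector_derivative_works)

lemma knots_cases:
  fixes r :: "nat \<Rightarrow> real"
  assumes "n \<ge> 1"
  obtains "x < r 1" | j where "j \<in> {1..n}" "x = r j"
    | j where "j \<in> {1..<n}" "x \<in> {r j<..<r (Suc j)}" | "x > r n"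
proof (cases "x < r 1")
  case False
  define j where "j = Max {j \<in> {1..n}. r j \<le> x}"
  have "j \<in> {j \<in> {1..n}. r j \<le> x}"
    unfolding j_def using False assms by (intro Max_in) auto
  then have j: "j \<in> {1..n}" "r j \<le> x" by auto
  have "x < r (Suc j)" if "j < n"
  proof (rule ccontr)
    assume "\<not> x < r (Suc j)"
    then have "Suc j \<le> j"
      unfolding j_def[symmetric] using that
      by (subst (2) j_def, intro Max_ge) auto
    then show False by simp
  qed
  then consider "x = r j" | "j < n" "r j < x" "x < r (Suc j)" | "j = n" "r j < x"
    using j by force
  then show thesis
  proof cases
    case 1
    then show ?thesis using j that(2) by blast
  next
    case 2
    then show ?thesis using j that(3)[of j] by auto
  next
    case 3
    then show ?thesis using that(4) by blast
  qed
qed (use that in blast)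

text \<open>A real-linear functional \<open>\<phi>\<close>, in practice the real or imaginary part, turns the complex
  differential equations into real ones. The equations \<open>L0 f = 0\<close> and \<open>R0 f = 0\<close> integrate once,
  because \<open>L0 f\<close> is minus the derivative of \<open>f'/x - (x f'')'\<close> and \<open>x\<^sup>2 R0 f = (x f')'\<close>; before the
  first knot, non-singularity gives the form of \<open>f\<close> directly.\<close>

lemma real_spline_data_component:
  fixes \<phi> :: "complex \<Rightarrow> real"
  assumes n: "n \<ge> 1" and r: "0 < r 1" "strict_mono_on {1..n} r"
    and \<sigma>: "\<sigma> \<in> beppo_levi_splines n r" and ns: "nonsingular_spline r \<sigma>"
    and \<phi>: "bounded_linear \<phi>"
  obtains a d where "real_spline_data n r a d (\<lambda>x. \<phi> (\<sigma> x)) (\<lambda>x. \<phi> (nderiv 1 \<sigma> x)) (\<lambda>x. \<phi> (nderiv 2 \<sigma> x))"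
proof -
  define U where "U = (\<lambda>k x. \<phi> (nderiv k \<sigma> x))"
  have \<phi>_simps: "\<phi> (x + y) = \<phi> x + \<phi> y" "\<phi> (x - y) = \<phi> x - \<phi> y" "\<phi> (c *\<^sub>R x) = c * \<phi> x" "\<phi> 0 = 0" for x y c
    using linear_add linear_diff linear_scale linear_0 \<phi>[THEN bounded_linear.linear] by (metis real_scaleR_def)+
  have deriv: "(U k has_real_derivative U (Suc k) x) (at x)"
    if "times_differentiable_on m S \<sigma>" "k < m" "x \<in> S" for m S k x
    unfolding U_def has_real_derivative_iff_has_vector_derivative
    by (rule bounded_linear.has_vector_derivative[OF \<phi> nderiv_has_vector_derivative[OF that]])
  have mid: "times_differentiable_on 4 {r j<..<r (Suc j)} \<sigma>" "\<And>x. x \<in> {r j<..<r (Suc j)} \<Longrightarrow> L0 \<sigma> x = 0"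
    if "j \<in> {1..<n}" for j
    using \<sigma> that by (auto simp: beppo_levi_splines_def)
  have inner: "times_differentiable_on 3 {0<..<r 1} \<sigma>" and outer: "times_differentiable_on 2 {r n<..} \<sigma>"
    and R0: "\<And>x. x \<in> {r n<..} \<Longrightarrow> R0 \<sigma> x = 0"
    and knot: "\<And>j. j \<in> {1..n} \<Longrightarrow> Cm_at 2 \<sigma> (r j)"
    using \<sigma> by (auto simp: beppo_levi_splines_def)
  have r_pos: "0 < r j" if "j \<in> {1..n}" for j
    using strict_mono_onD[OF r(2), of 1 j] that r(1) by (cases "j = 1") auto
  have outer_eq: "U 2 x = - (U 1 x / x)" if "x > r n" for x
  proof -
    have "x > 0" using that r_pos[of n] n by auto
    moreover have "\<phi> (R0 \<sigma> x) = 0" using R0 that \<phi>_simps by simp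
    ultimately show ?thesis by (simp add: R0_def \<phi>_simps U_def divide_eq_0_iff)
  qed
  have C2: "(U 0 has_real_derivative U 1 x) (at x) \<and> (U 1 has_real_derivative U 2 x) (at x) \<and> isCont (U 2) x"
    if "x > 0" for x
  proof (rule knots_cases[OF n, of x r])
    assume "x < r 1"
    then have "x \<in> {0<..<r 1}" using that by simp
    from deriv[OF inner _ this, of 0] deriv[OF inner _ this, of 1] deriv[OF inner _ this, of 2]
    show ?thesis by (auto simp: numeral_2_eq_2 intro: DERIV_isCont)
  next
    fix j assume j: "j \<in> {1..n}" "x = r j"
    obtain V where V: "open V" "x \<in> V" "times_differentiable_on 2 V \<sigma>" "continuous_on V (nderiv 2 \<sigma>)"
      using knot[OF j(1)] j(2) by (auto simp: Cm_at_def)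
    have "isCont (nderiv 2 \<sigma>) x" using V continuous_on_eq_continuous_at by blast
    then have "isCont (U 2) x" unfolding U_def by (intro bounded_linear.isCont[OF \<phi>])
    then show ?thesis
      using deriv[OF V(3) _ V(2), of 0] deriv[OF V(3) _ V(2), of 1] by (simp add: numeral_2_eq_2)
  next
    fix j assume "j \<in> {1..<n}" and x: "x \<in> {r j<..<r (Suc j)}"
    note m = mid(1)[OF this(1)]
    from deriv[OF m _ x, of 0] deriv[OF m _ x, of 1] deriv[OF m _ x, of 2]
    show ?thesis by (auto simp: numeral_2_eq_2 intro: DERIV_isCont)
  next
    assume x: "x > r n"
    have d: "(U 0 has_real_derivative U 1 x) (at x)" "(U 1 has_real_derivative U 2 x) (at x)"
      using deriv[OF outer, of 0 x] deriv[OF outer, of 1 x] x by (auto simp: numeral_2_eq_2)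
    \<comment> \<open>Beyond the last knot only two derivatives are given, but the equation itself expresses the second one by the first.\<close>
    have "isCont (\<lambda>x. - (U 1 x / x)) x"
      using DERIV_isCont[OF d(2)] that by (intro continuous_intros) auto
    moreover have "eventually (\<lambda>y. U 2 y = - (U 1 y / y)) (nhds x)"
      using eventually_nhds_in_open[of "{r n<..}" x] x by (auto elim!: eventually_mono simp: outer_eq)
    ultimately have "isCont (U 2) x" using isCont_cong[of "U 2" "\<lambda>y. - (U 1 y / y)" x] by blast
    with d show ?thesis by blast
  qed
  have EL: "\<exists>g. \<forall>x\<in>{r j<..<r (Suc j)}. ((\<lambda>x. x * U 2 x) has_real_derivative U 1 x / x - g) (at x)"
    if j: "j \<in> {1..<n}" for j
  proof -
    let ?I = "{r j<..<r (Suc j)}"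
    have pos: "x > 0" if "x \<in> ?I" for x using r_pos[of j] j that by auto
    have D: "(U 1 has_real_derivative U 2 x) (at x)" "(U 2 has_real_derivative U 3 x) (at x)"
      "(U 3 has_real_derivative U 4 x) (at x)" if "x \<in> ?I" for x
      using deriv[OF mid(1)[OF j] _ that, of 1] deriv[OF mid(1)[OF j] _ that, of 2]
        deriv[OF mid(1)[OF j] _ that, of 3] by (simp_all add: eval_nat_numeral)
    have "\<exists>g. \<forall>x\<in>?I. U 1 x / x - U 2 x - x * U 3 x = g"
    proof (rule has_field_derivative_zero_constant)
      fix x assume x: "x \<in> ?I"
      have "\<phi> (L0 \<sigma> x) = 0" using mid(2)[OF j x] \<phi>_simps by simp
      then have L: "x * U 4 x + 2 * U 3 x - 1 / x * U 2 x + 1 / x\<^sup>2 * U 1 x = 0"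
        by (simp add: L0_def \<phi>_simps U_def)
      have "((\<lambda>x. U 1 x / x - U 2 x - x * U 3 x) has_real_derivative
          (U 2 x * x - U 1 x * 1) / (x * x) - U 3 x - (1 * U 3 x + U 4 x * x)) (at x)"
        using pos[OF x] by (intro DERIV_diff DERIV_mult DERIV_divide D x DERIV_ident) auto
      moreover have "(U 2 x * x - U 1 x * 1) / (x * x) - U 3 x - (1 * U 3 x + U 4 x * x) = 0"
        using L pos[OF x] by (simp add: field_simps power2_eq_square)
      ultimately show "((\<lambda>x. U 1 x / x - U 2 x - x * U 3 x) has_real_derivative 0) (at x within ?I)"
        by (metis has_field_derivative_at_within)
    qed simp
    then obtain g where g: "\<And>x. x \<in> ?I \<Longrightarrow> U 1 x / x - U 2 x - x * U 3 x = g" by blast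
    have "((\<lambda>x. x * U 2 x) has_real_derivative U 1 x / x - g) (at x)" if "x \<in> ?I" for x
    proof -
      have "((\<lambda>x. x * U 2 x) has_real_derivative (1 * U 2 x + U 3 x * x)) (at x)"
        by (intro DERIV_mult D that DERIV_ident)
      moreover have "1 * U 2 x + U 3 x * x = U 1 x / x - g" using g[OF that] by (simp add: algebra_simps)
      ultimately show ?thesis by simp
    qed
    then show ?thesis by blast
  qed
  obtain a b where ab: "\<And>x. x \<in> {0<..<r 1} \<Longrightarrow> \<sigma> x = a * of_real (x\<^sup>2) + b"
    using ns unfolding nonsingular_spline_def by blast
  define A where "A = 2 * \<phi> a"
  have near0: "U 1 x = A * x \<and> U 2 x = A" if x: "x \<in> {0<..<r 1}" for x
  proof -
    have U0: "U 0 y = \<phi> a * y\<^sup>2 + \<phi> b" if "y \<in> {0<..<r 1}" for y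
    proof -
      have "\<sigma> y = y\<^sup>2 *\<^sub>R a + b" using ab[OF that] by (simp add: scaleR_conv_of_real mult.commute)
      then show ?thesis by (simp add: U_def nderiv_def \<phi>_simps)
    qed
    have U1: "U 1 y = A * y" if y: "y \<in> {0<..<r 1}" for y
    proof (rule DERIV_unique)
      show "(U 0 has_real_derivative U 1 y) (at y)" using C2 y by simp
      have "((\<lambda>y. \<phi> a * y\<^sup>2 + \<phi> b) has_real_derivative A * y) (at y)"
        by (auto intro!: derivative_eq_intros simp: A_def)
      then show "(U 0 has_real_derivative A * y) (at y)"
        by (rule has_field_derivative_transform_within_open[of _ _ _ "{0<..<r 1}"]) (use y U0 in auto)
    qed
    have "U 2 x = A"
    proof (rule DERIV_unique)
      show "(U 1 has_real_derivative U 2 x) (at x)" using C2 x by simp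
      have "((\<lambda>y. A * y) has_real_derivative A) (at x)"
        by (auto intro!: derivative_eq_intros)
      then show "(U 1 has_real_derivative A) (at x)"
        by (rule has_field_derivative_transform_within_open[of _ _ _ "{0<..<r 1}"]) (use x U1 in auto)
    qed
    with U1[OF x] show ?thesis by blast
  qed
  have "\<exists>d. \<forall>x\<in>{r n<..}. x * U 1 x = d"
  proof (rule has_field_derivative_zero_constant)
    fix x assume x: "x \<in> {r n<..}"
    then have "x > 0" using r_pos[of n] n by auto
    then have "((\<lambda>x. x * U 1 x) has_real_derivative (1 * U 1 x + U 2 x * x)) (at x)"
      using C2 by (intro DERIV_mult DERIV_ident) auto
    moreover have "1 * U 1 x + U 2 x * x = 0" using outer_eq[of x] x \<open>x > 0\<close> by simp
    ultimately show "((\<lambda>x. x * U 1 x) has_real_derivative 0) (at x within {r n<..})"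
      by (metis has_field_derivative_at_within)
  qed simp
  then obtain d where d: "\<And>x. x > r n \<Longrightarrow> x * U 1 x = d" by auto
  have far: "U 1 x = d / x \<and> U 2 x = - (d / x\<^sup>2)" if "x > r n" for x
  proof -
    have "x > 0" using that r_pos[of n] n by auto
    then have "U 1 x = d / x" using d[OF that] by (auto simp: field_simps)
    then show ?thesis using outer_eq[OF that] by (simp add: power2_eq_square)
  qed
  have "real_spline_data n r A d (U 0) (U 1) (U 2)"
    unfolding real_spline_data_def using C2 EL near0 far by blast
  then show thesis using that by (simp add: U_def nderiv_def)
qed

theorem proposition1:
  fixes n :: nat and r \<nu> :: "nat \<Rightarrow> real"
    and \<sigma> :: "real \<Rightarrow> complex" and s :: "real \<Rightarrow> real \<Rightarrow> real \<Rightarrow> real"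
  assumes "n \<ge> 1" and "0 < r 1" and "strict_mono_on {1..n} r"
    and "\<sigma> \<in> beppo_levi_splines n r" and "nonsingular_spline r \<sigma>"
    and "\<And>j. j \<in> {1..n} \<Longrightarrow> \<sigma> (r j) = of_real (\<nu> j)"
    and "\<And>R1 R2. \<lbrakk>0 < R1; R1 < R2; r ` {1..n} \<subseteq> {R1..R2}\<rbrakk>
           \<Longrightarrow> constrained_minimizer n r \<nu> R1 R2 (s R1 R2)"
  shows "\<forall>x>0. ((\<lambda>(R1, R2). complex_of_real (s R1 R2 x)) \<longlongrightarrow> \<sigma> x) (at_right 0 \<times>\<^sub>F at_top)"
proof (intro allI impI)
  fix x :: real assume "x > 0"
  have mono: "r i \<le> r j" if "i \<le> j" "i \<in> {1..n}" "j \<in> {1..n}" for i j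
    using strict_mono_onD[OF assms(3)] that by (cases "i = j") (auto simp: less_le)
  obtain a d where re: "real_spline_data n r a d (\<lambda>x. Re (\<sigma> x)) (\<lambda>x. Re (nderiv 1 \<sigma> x)) (\<lambda>x. Re (nderiv 2 \<sigma> x))"
    using real_spline_data_component[OF assms(1-5) bounded_linear_Re] .
  obtain a' d' where im: "real_spline_data n r a' d' (\<lambda>x. Im (\<sigma> x)) (\<lambda>x. Im (nderiv 1 \<sigma> x)) (\<lambda>x. Im (nderiv 2 \<sigma> x))"
    using real_spline_data_component[OF assms(1-5) bounded_linear_Im] .
  have ivl: "R1 < R2" "r ` {1..n} \<subseteq> {R1..R2}" if "R1 < r 1" "r n < R2" for R1 R2
    using mono[of 1] mono[of _ n] mono[of 1 n] that assms(1) by force+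
  have adm: "u \<in> admissible R1 R2" if "real_spline_data n r b e u u1 u2" "0 < R1" "R1 < R2"
    for u u1 u2 b e R1 R2
    using that by (intro C2_imp_admissible(1)[of R1 R2 u u1 u2])
      (auto simp: real_spline_data_def intro!: continuous_at_imp_continuous_on)
  have lim_Re: "((\<lambda>(R1, R2). s R1 R2 x) \<longlongrightarrow> Re (\<sigma> x)) (at_right 0 \<times>\<^sub>F at_top)"
  proof (rule tendsto_spline[OF re assms(1,3,2) _ \<open>x > 0\<close>])
    fix R1 R2 :: real assume R: "0 < R1" "R1 < r 1" "r n < R2"
    have min: "constrained_minimizer n r \<nu> R1 R2 (s R1 R2)"
      using R ivl by (intro assms(7)) auto
    have "(\<lambda>x. Re (\<sigma> x)) \<in> admissible R1 R2"
      using adm[OF re] ivl R by blast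
    then have "energy R1 R2 (s R1 R2) \<le> energy R1 R2 (\<lambda>x. Re (\<sigma> x))"
      using min assms(6) unfolding constrained_minimizer_def is_arg_min_linorder by auto
    then show "s R1 R2 \<in> admissible R1 R2 \<and> (\<forall>j\<in>{1..n}. s R1 R2 (r j) = Re (\<sigma> (r j))) \<and>
      energy R1 R2 (s R1 R2) \<le> energy R1 R2 (\<lambda>x. Re (\<sigma> x))"
      using min assms(6) unfolding constrained_minimizer_def is_arg_min_linorder by auto
  qed
  \<comment> \<open>The zero function has least energy among all functions, and it matches the zero data of the imaginary part.\<close>
  have lim_Im: "((\<lambda>(R1, R2). 0) \<longlongrightarrow> Im (\<sigma> x)) (at_right (0::real) \<times>\<^sub>F (at_top :: real filter))"
  proof (rule tendsto_spline[OF im assms(1,3,2) _ \<open>x > 0\<close>, where s = "\<lambda>_ _ _. 0"])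
    fix R1 R2 :: real assume R: "0 < R1" "R1 < r 1" "r n < R2"
    have "R1 < R2" using R ivl by blast
    note zero = C2_imp_admissible[OF \<open>R1 < R2\<close>, of "\<lambda>_. 0" "\<lambda>_. 0" "\<lambda>_. 0"]
    have "energy R1 R2 (\<lambda>_. 0) = integral\<^sup>L (lebesgue_on {R1..R2}) (\<lambda>_. 0 :: real)"
      unfolding energy_def Let_def using zero by (intro Bochner_Integration.integral_cong) auto
    also have "\<dots> \<le> energy R1 R2 (\<lambda>x. Im (\<sigma> x))"
      using R unfolding energy_def Let_def by (subst Bochner_Integration.integral_zero, intro Bochner_Integration.integral_nonneg) auto
    finally show "(\<lambda>_. 0) \<in> admissible R1 R2 \<and> (\<forall>j\<in>{1..n}. 0 = Im (\<sigma> (r j))) \<and>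
      energy R1 R2 (\<lambda>_. 0) \<le> energy R1 R2 (\<lambda>x. Im (\<sigma> x))"
      using zero(1) assms(6) by auto
  qed
  have "at_right (0::real) \<times>\<^sub>F (at_top :: real filter) \<noteq> bot"
    by (simp add: prod_filter_eq_bot)
  then have "Im (\<sigma> x) = 0"
    using tendsto_unique[OF _ lim_Im, of 0] by (simp add: case_prod_unfold)
  then have "\<sigma> x = of_real (Re (\<sigma> x))" by (simp add: complex_eq_iff)
  then show "((\<lambda>(R1, R2). complex_of_real (s R1 R2 x)) \<longlongrightarrow> \<sigma> x) (at_right 0 \<times>\<^sub>F at_top)"
    using tendsto_of_real[OF lim_Re, where 'a = complex] by (simp add: case_prod_unfold)
qed

end
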